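(* Let $A,B\in\mathscr{B}(H)$ be bounded positive operators on the complex Hilbert space $H$. Let $S_A,S_B:H_{A+B}\to H$ be the contractions determined by $S_A((A+B)x)=A^{1/2}x$ and $S_B((A+B)x)=B^{1/2}x$, $x\in H$. Then $$A:B=A^{1/2}(I-S_AS_A^* )A^{1/2}=B^{1/2}(I-S_BS_B^* )B^{1/2},$$ where $I$ is the identity operator of $H$.
   Context: Inner products are linear in the first variable. A bounded operator $A$ on $H$ is positive if $(Ax\mid x)\ge0$ for all $x\in H$. For a bounded positive operator $C$ on $H$, $H_C$ denotes the Hilbert space completion of $\operatorname{ran}C$ equipped with the inner product $(Cx\mid Cy)_C:=(Cx\mid y)$, $x,y\in H$; here $C=A+B$. The operators $S_A,S_B$, given on the dense subspace $\operatorname{ran}(A+B)$ of $H_{A+B}$, are contractive and extended by continuity to all of $H_{A+B}$. The parallel sum $A:B$ is the unique bounded positive operator on $H$ with quadratic form $$((A:B)x\mid x)=\inf\{(A(x-y)\mid x-y)+(By\mid y):y\in H\},\qquad x\in H.$$ *)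

theory Defs
  imports "HOL-Analysis.Analysis" "HOL-Library.Nonpos_Ints"
begin

text \<open>
  Complex inner product spaces are built on top of the library class of real inner product
  spaces, the real inner product being the real part of the complex one. Hence the norm, the
  topology and the positive definiteness of \<open>cinner\<close> are those of \<open>real_inner\<close>.
  The complex inner product is linear in the first variable.
\<close>

class complex_inner = real_inner +
  fixes scaleC :: "complex \<Rightarrow> 'a \<Rightarrow> 'a" (infixr \<open>*\<^sub>C\<close> 75)
    and cinner :: "'a \<Rightarrow> 'a \<Rightarrow> complex"
  assumes scaleC_add_right: "c *\<^sub>C (x + y) = c *\<^sub>C x + c *\<^sub>C y"
    and scaleC_add_left: "(c + d) *\<^sub>C x = c *\<^sub>C x + d *\<^sub>C x"
    and scaleC_scaleC: "c *\<^sub>C (d *\<^sub>C x) = (c * d) *\<^sub>C x"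
    and scaleC_of_real: "complex_of_real r *\<^sub>C x = r *\<^sub>R x"
    and cinner_commute: "cinner x y = cnj (cinner y x)"
    and cinner_add_left: "cinner (x + y) z = cinner x z + cinner y z"
    and cinner_scaleC_left: "cinner (c *\<^sub>C x) y = c * cinner x y"
    and inner_eq_Re_cinner: "inner x y = Re (cinner x y)"

class chilbert_space = complex_inner + complete_space

definition csubspace :: "'a::complex_inner set \<Rightarrow> bool" where
  "csubspace V \<longleftrightarrow>
     0 \<in> V \<and> (\<forall>x\<in>V. \<forall>y\<in>V. x + y \<in> V) \<and> (\<forall>c. \<forall>x\<in>V. c *\<^sub>C x \<in> V)"

definition clinear_on :: "'a::complex_inner set \<Rightarrow> ('a \<Rightarrow> 'b::complex_inner) \<Rightarrow> bool" where
  "clinear_on V T \<longleftrightarrow>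
     (\<forall>x\<in>V. \<forall>y\<in>V. T (x + y) = T x + T y) \<and> (\<forall>c. \<forall>x\<in>V. T (c *\<^sub>C x) = c *\<^sub>C T x)"

definition bounded_clinear :: "('a::complex_inner \<Rightarrow> 'b::complex_inner) \<Rightarrow> bool" where
  "bounded_clinear T \<longleftrightarrow> bounded_linear T \<and> clinear_on UNIV T"

definition contraction_on :: "'a::complex_inner set \<Rightarrow> ('a \<Rightarrow> 'b::complex_inner) \<Rightarrow> bool" where
  "contraction_on V T \<longleftrightarrow> clinear_on V T \<and> (\<forall>x\<in>V. norm (T x) \<le> norm x)"

definition positive_op :: "('a::complex_inner \<Rightarrow> 'a) \<Rightarrow> bool" where
  "positive_op A \<longleftrightarrow> bounded_clinear A \<and> (\<forall>x. cinner (A x) x \<in> \<real>\<^sub>\<ge>\<^sub>0)"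

definition op_sqrt :: "('a::chilbert_space \<Rightarrow> 'a) \<Rightarrow> 'a \<Rightarrow> 'a" where
  "op_sqrt A = (THE R. positive_op R \<and> R \<circ> R = A)"

text \<open>The infimum is taken over a nonempty set of nonnegative reals.\<close>

definition parallel_sum :: "('a::chilbert_space \<Rightarrow> 'a) \<Rightarrow> ('a \<Rightarrow> 'a) \<Rightarrow> 'a \<Rightarrow> 'a" where
  "parallel_sum A B = (THE T. positive_op T \<and>
     (\<forall>x. cinner (T x) x =
       complex_of_real (INF y. Re (cinner (A (x - y)) (x - y)) + Re (cinner (B y) y))))"

text \<open>
  \<open>range_completion C K j\<close>: the Hilbert space \<open>K\<close>, together with the embedding \<open>j\<close> of the
  range of \<open>C\<close>, is a completion of the range of \<open>C\<close> with respect to the inner product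
  \<open>(Cx | Cy) = cinner (C x) y\<close>. A completion is determined only up to unitary equivalence, and
  its type cannot depend on \<open>C\<close>, so \<open>K\<close> is a complete subspace of some inner product space:
  \<open>K = UNIV\<close> covers any Hilbert space given as a type, and a realisation always exists with
  \<open>'k = 'a\<close>, namely \<open>j (C x) = op_sqrt C x\<close> and \<open>K = closure (range (op_sqrt C))\<close>.
  Values of \<open>j\<close> off \<open>range C\<close> are irrelevant.
\<close>

definition range_completion ::
    "('a::chilbert_space \<Rightarrow> 'a) \<Rightarrow> 'k::complex_inner set \<Rightarrow> ('a \<Rightarrow> 'k) \<Rightarrow> bool" where
  "range_completion C K j \<longleftrightarrow>
     csubspace K \<and> complete K \<and>
     clinear_on (range C) j \<and>
     (\<forall>x y. cinner (j (C x)) (j (C y)) = cinner (C x) y) \<and>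
     j ` range C \<subseteq> K \<and> K \<subseteq> closure (j ` range C)"

text \<open>The Hilbert space adjoint of \<open>T : K \<rightarrow> H\<close>, as a map \<open>H \<rightarrow> K\<close>.\<close>

definition adjoint_on ::
    "'k::complex_inner set \<Rightarrow> ('k \<Rightarrow> 'a::chilbert_space) \<Rightarrow> 'a \<Rightarrow> 'k" where
  "adjoint_on K T h = (THE k. k \<in> K \<and> (\<forall>z\<in>K. cinner (T z) h = cinner z k))"

end

theory Submission
  imports Defs
begin

text \<open>
  Write \<open>a\<close> for the square root of \<open>A\<close>, \<open>P\<close> for the adjoint of \<open>S\<^sub>A\<close> and \<open>V y = j ((A + B) y)\<close>.
  Since \<open>S\<^sub>A (V y) = a y\<close> and \<open>(V y | V y) = (A y | y) + (B y | y)\<close>, completing the square gives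
  \<open>(A (x - y) | x - y) + (B y | y) = (a x | a x) - (P (a x) | P (a x)) + \<parallel>P (a x) - V y\<parallel>\<^sup>2\<close>.
  The range of \<open>V\<close> is dense in \<open>K\<close>, so the infimum over \<open>y\<close> is the quadratic form of
  \<open>a (I - S\<^sub>A P) a\<close>, and a positive operator is determined by its quadratic form. The formula for
  \<open>B\<close> follows because the parallel sum is symmetric.
\<close>

instance chilbert_space \<subseteq> banach ..

section \<open>Nonnegative quadratic forms and Cauchy-Schwarz\<close>

lemma discriminant_le_if_nonneg:
  fixes a b c :: real
  assumes "\<And>t. 0 \<le> a + 2 * t * b + t\<^sup>2 * c" and "0 \<le> c"
  shows "b\<^sup>2 \<le> a * c"
proof (cases "c = 0")
  case True
  have "b = 0"
  proof (rule ccontr)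
    assume "b \<noteq> 0"
    \<comment> \<open>With \<open>c = 0\<close> the quadratic is affine in \<open>t\<close>, and
      this \<open>t\<close> gives it the value -1.\<close>
    then show False using assms(1)[of "- (a + 1) / (2 * b)"] True by (simp add: field_simps)
  qed
  then show ?thesis using True by simp
next
  case False
  then have "0 < c" using assms(2) by simp
  \<comment> \<open>The minimum over \<open>t\<close> lies at \<open>- b / c\<close>; the outer
    factor \<open>c\<close> clears the denominator.\<close>
  have "0 \<le> c * (a + 2 * (- b / c) * b + (- b / c)\<^sup>2 * c)"
    using assms(1)[of "- b / c"] \<open>0 < c\<close> by simp
  also have "\<dots> = a * c - b\<^sup>2"
    using \<open>0 < c\<close> by (simp add: field_simps power2_eq_square)
  finally show ?thesis by simp
qed

lemma positive_form_Cauchy_Schwarz: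
  fixes D :: "'a::real_inner \<Rightarrow> 'a"
  assumes "linear D" "\<And>x y. D x \<bullet> y = x \<bullet> D y" "\<And>x. 0 \<le> D x \<bullet> x"
  shows "(D x \<bullet> y)\<^sup>2 \<le> (D x \<bullet> x) * (D y \<bullet> y)"
proof (rule discriminant_le_if_nonneg)
  fix t
  have "D (x + t *\<^sub>R y) \<bullet> (x + t *\<^sub>R y) = D x \<bullet> x + 2 * t * (D x \<bullet> y) + t\<^sup>2 * (D y \<bullet> y)"
    using assms(2)[of y x]
    by (simp add: linear_add[OF assms(1)] linear_scale[OF assms(1)] inner_add inner_commute
        power2_eq_square algebra_simps)
  then show "0 \<le> D x \<bullet> x + 2 * t * (D x \<bullet> y) + t\<^sup>2 * (D y \<bullet> y)"
    using assms(3)[of "x + t *\<^sub>R y"] by simp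
qed (rule assms(3))

text \<open>Cauchy-Schwarz with \<open>y = D x\<close> bounds the fourth power of
  \<open>norm (D x)\<close> by 0. Applied to a difference of operators, this recovers a symmetric
  operator from its quadratic form.\<close>

lemma symmetric_form_zero_imp:
  fixes D :: "'a::real_inner \<Rightarrow> 'a"
  assumes "linear D" "\<And>x y. D x \<bullet> y = x \<bullet> D y" "\<And>x. D x \<bullet> x = 0"
  shows "D x = 0"
  using positive_form_Cauchy_Schwarz[OF assms(1,2), of x "D x"] by (simp add: assms(3))

lemma positive_form_kernel:
  fixes D :: "'a::real_inner \<Rightarrow> 'a"
  assumes "linear D" "\<And>x y. D x \<bullet> y = x \<bullet> D y" "\<And>x. 0 \<le> D x \<bullet> x" "D x \<bullet> x = 0"
  shows "D x = 0"
  using positive_form_Cauchy_Schwarz[OF assms(1-3), of x "D x"] by (simp add: assms(4))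

subsection \<open>The Riesz representation theorem on a complete subspace\<close>

text \<open>If \<open>k\<close> represents \<open>f\<close>, completing the square gives
  \<open>\<phi> z = (norm (z - k))^2 - (norm k)^2\<close>. So \<open>k\<close> is sought as the
  minimiser of \<open>\<phi>\<close> over \<open>K\<close>, and completeness provides it.\<close>

lemma riesz_representation_on:
  fixes K :: "'a::real_inner set" and f :: "'a \<Rightarrow> real"
  assumes K: "subspace K" "complete K"
    and add: "\<And>x y. x \<in> K \<Longrightarrow> y \<in> K \<Longrightarrow> f (x + y) = f x + f y"
    and scale: "\<And>r x. x \<in> K \<Longrightarrow> f (r *\<^sub>R x) = r * f x"
    and bound: "\<And>x. x \<in> K \<Longrightarrow> \<bar>f x\<bar> \<le> M * norm x"
  shows "\<exists>k\<in>K. \<forall>z\<in>K. f z = z \<bullet> k"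
proof -
  define \<phi> where "\<phi> z = (norm z)\<^sup>2 - 2 * f z" for z
  define d where "d = Inf (\<phi> ` K)"
  have K0: "0 \<in> K" by (rule subspace_0[OF K(1)])
  have "- M\<^sup>2 \<le> \<phi> z" if "z \<in> K" for z
  proof -
    have "0 \<le> (norm z - M)\<^sup>2" by simp
    then show ?thesis using bound[OF that] unfolding \<phi>_def
      by (simp add: power2_eq_square algebra_simps)
  qed
  then have bdd: "bdd_below (\<phi> ` K)" by (intro bdd_belowI2)
  have d: "d \<le> \<phi> z" if "z \<in> K" for z
    unfolding d_def using that bdd by (auto intro: cInf_lower)
  have "\<exists>z\<in>K. \<phi> z < d + inverse (Suc n)" for n :: nat
    using cInf_lessD[of "\<phi> ` K" "d + inverse (Suc n)"] K0 unfolding d_def by auto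
  then obtain z where z: "\<And>n. z n \<in> K" "\<And>n. \<phi> (z n) < d + inverse (Suc n)" by metis
  \<comment> \<open>Parallelogram law, with the midpoint of \<open>v\<close> and \<open>w\<close>
    contributing at least \<open>d\<close>; it makes a minimising sequence Cauchy.\<close>
  have par: "(norm (v - w))\<^sup>2 \<le> 2 * \<phi> v + 2 * \<phi> w - 4 * d" if "v \<in> K" "w \<in> K" for v w
  proof -
    have m: "(1/2) *\<^sub>R (v + w) \<in> K" using that K(1) by (simp add: subspace_add subspace_scale)
    have "4 * \<phi> ((1/2) *\<^sub>R (v + w)) = (norm (v + w))\<^sup>2 - 4 * (f v + f w)"
      using that K(1) unfolding \<phi>_def
      by (simp add: add scale subspace_add power_divide) (simp add: field_simps)
    also have "\<dots> = 2 * \<phi> v + 2 * \<phi> w - (norm (v - w))\<^sup>2"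
      unfolding \<phi>_def by (simp add: power2_norm_eq_inner inner_add inner_diff algebra_simps)
    finally show ?thesis using d[OF m] by simp
  qed
  have "Cauchy z"
  proof (rule metric_CauchyI)
    fix e :: real assume "0 < e"
    \<comment> \<open>Two terms that each exceed \<open>d\<close> by less than
      \<open>e^2 / 4\<close> make the bound in \<open>par\<close> smaller than
      \<open>e^2\<close>.\<close>
    then have "0 < e\<^sup>2 / 4" by simp
    then obtain N where N: "inverse (real (Suc N)) < e\<^sup>2 / 4" using reals_Archimedean by blast
    have "dist (z m) (z n) < e" if "N \<le> m" "N \<le> n" for m n
    proof -
      have "inverse (real (Suc m)) \<le> inverse (real (Suc N))"
        "inverse (real (Suc n)) \<le> inverse (real (Suc N))"
        using that by (auto intro: le_imp_inverse_le)
      then have "(norm (z m - z n))\<^sup>2 < e\<^sup>2"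
        using par[OF z(1) z(1), of m n] z(2)[of m] z(2)[of n] N by linarith
      then show ?thesis using \<open>0 < e\<close> by (simp add: dist_norm power2_less_imp_less)
    qed
    then show "\<exists>N. \<forall>m\<ge>N. \<forall>n\<ge>N. dist (z m) (z n) < e" by blast
  qed
  then obtain k where k: "k \<in> K" "z \<longlonglongrightarrow> k" using K(2) z(1) unfolding complete_def by blast
  have "(\<lambda>n. f (z n)) \<longlonglongrightarrow> f k"
  proof (rule LIM_zero_cancel, rule Lim_null_comparison)
    show "\<forall>\<^sub>F n in sequentially. norm (f (z n) - f k) \<le> M * norm (z n - k)"
    proof (rule always_eventually, rule allI)
      fix n
      have "f (z n) = f (z n - k) + f k"
        using add[of "z n - k" k] z(1) k(1) K(1) by (simp add: subspace_diff)
      then show "norm (f (z n) - f k) \<le> M * norm (z n - k)"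
        using bound[of "z n - k"] z(1) k(1) K(1) by (simp add: subspace_diff)
    qed
    show "(\<lambda>n. M * norm (z n - k)) \<longlonglongrightarrow> 0"
      using k(2) by (intro tendsto_mult_right_zero tendsto_norm_zero LIM_zero)
  qed
  then have "(\<lambda>n. \<phi> (z n)) \<longlonglongrightarrow> \<phi> k"
    unfolding \<phi>_def by (intro tendsto_intros k(2))
  moreover have "(\<lambda>n. d + inverse (real (Suc n))) \<longlonglongrightarrow> d + 0"
    by (intro tendsto_intros LIMSEQ_inverse_real_of_nat)
  ultimately have "\<phi> k \<le> d + 0"
    by (rule LIMSEQ_le) (meson less_imp_le z(2))
  then have min: "\<phi> k \<le> \<phi> v" if "v \<in> K" for v using d[OF that] by simp
  have "f v = v \<bullet> k" if v: "v \<in> K" for v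
  proof -
    \<comment> \<open>First variation at the minimiser: the increment of \<open>\<phi>\<close> is a
      nonnegative quadratic in \<open>t\<close> without constant term, so its linear coefficient
      vanishes.\<close>
    have "(k \<bullet> v - f v)\<^sup>2 \<le> 0 * (v \<bullet> v)"
    proof (rule discriminant_le_if_nonneg)
      fix t
      have "\<phi> (k + t *\<^sub>R v) = \<phi> k + 2 * t * (k \<bullet> v - f v) + t\<^sup>2 * (v \<bullet> v)"
        using v k(1) K(1) unfolding \<phi>_def
        by (simp add: add scale subspace_scale power2_norm_eq_inner inner_add inner_commute
            power2_eq_square[of t] algebra_simps)
      then show "0 \<le> 0 + 2 * t * (k \<bullet> v - f v) + t\<^sup>2 * (v \<bullet> v)"
        using min[of "k + t *\<^sub>R v"] v k(1) K(1) by (simp add: subspace_add subspace_scale)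
    qed simp
    then show ?thesis by (simp add: inner_commute)
  qed
  then show ?thesis using k(1) by blast
qed

subsection \<open>Square roots of positive operators\<close>

text \<open>Cauchy-Schwarz for the form of \<open>D\<close> with \<open>y = D x\<close>, both
  factors then being bounded by the last hypothesis; one factor \<open>D x \<bullet> D x\<close>
  cancels.\<close>

lemma norm_blinfun_positive_le:
  fixes D :: "'a::real_inner \<Rightarrow>\<^sub>L 'a"
  assumes "\<And>x y. D x \<bullet> y = x \<bullet> D y" "\<And>x. 0 \<le> D x \<bullet> x" "\<And>x. D x \<bullet> x \<le> x \<bullet> x"
  shows "norm D \<le> 1"
proof (rule norm_blinfun_bound)
  fix x
  have "(D x \<bullet> D x)\<^sup>2 \<le> (D x \<bullet> x) * (D (D x) \<bullet> D x)"
    by (rule positive_form_Cauchy_Schwarz)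
       (use assms in \<open>auto intro: bounded_linear.linear blinfun.bounded_linear_right\<close>)
  also have "\<dots> \<le> (x \<bullet> x) * (D x \<bullet> D x)"
    by (intro mult_mono assms) auto
  finally have "(D x \<bullet> D x) * (D x \<bullet> D x) \<le> (x \<bullet> x) * (D x \<bullet> D x)"
    by (simp add: power2_eq_square)
  then have "D x \<bullet> D x \<le> x \<bullet> x"
    by (metis inner_ge_zero mult_right_le_imp_le order_le_less)
  then show "norm (D x) \<le> 1 * norm x" by (simp add: norm_le)
qed simp

context
  fixes D :: "'a::{real_inner, banach} \<Rightarrow>\<^sub>L 'a"
begin

text \<open>Fixed-point iteration for \<open>Y = (D + Y^2) / 2\<close>, an equation equivalent to
  \<open>(I - Y)^2 = I - D\<close>.\<close>

primrec sqrt_iter :: "nat \<Rightarrow> 'a \<Rightarrow>\<^sub>L 'a" where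
  "sqrt_iter 0 = 0"
| "sqrt_iter (Suc n) = (1/2) *\<^sub>R (D + (sqrt_iter n o\<^sub>L sqrt_iter n))"

end

text \<open>The scalar iteration with \<open>D = 1\<close>. It is increasing and bounded, so its
  increments are summable, and it dominates the operator iteration when
  \<open>norm D \<le> 1\<close>.\<close>

primrec sqrt_majorant :: "nat \<Rightarrow> real" where
  "sqrt_majorant 0 = 0"
| "sqrt_majorant (Suc n) = (1 + (sqrt_majorant n)\<^sup>2) / 2"

lemma sqrt_majorant_bounds: "0 \<le> sqrt_majorant n \<and> sqrt_majorant n \<le> 1"
proof (induction n)
  case (Suc n)
  then have "(sqrt_majorant n)\<^sup>2 \<le> 1" by (simp add: power_le_one)
  then show ?case by simp
qed simp

lemma sqrt_majorant_mono: "sqrt_majorant n \<le> sqrt_majorant (Suc n)"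
proof -
  have "0 \<le> (1 - sqrt_majorant n)\<^sup>2" by simp
  then show ?thesis by (simp add: power2_eq_square algebra_simps)
qed

lemma norm_sqrt_iter:
  assumes "norm D \<le> 1"
  shows "norm (sqrt_iter D n) \<le> sqrt_majorant n"
proof (induction n)
  case (Suc n)
  have "norm (sqrt_iter D n o\<^sub>L sqrt_iter D n) \<le> norm (sqrt_iter D n) * norm (sqrt_iter D n)"
    by (rule norm_blinfun_compose)
  also have "\<dots> \<le> sqrt_majorant n * sqrt_majorant n"
    using Suc sqrt_majorant_bounds by (intro mult_mono) auto
  finally show ?case
    using norm_triangle_ineq[of D "sqrt_iter D n o\<^sub>L sqrt_iter D n"] assms
    by (simp add: power2_eq_square)
qed simp

text \<open>Induction through \<open>Q^2 - P^2 = Q (Q - P) + (Q - P) P\<close>, valid without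
  commutativity; the scalar majorant obeys the same identity.\<close>

lemma norm_sqrt_iter_diff:
  assumes "norm D \<le> 1"
  shows "norm (sqrt_iter D (Suc n) - sqrt_iter D n) \<le> sqrt_majorant (Suc n) - sqrt_majorant n"
proof (induction n)
  case 0
  then show ?case using assms by simp
next
  case (Suc n)
  define P Q p q where "P = sqrt_iter D n" and "Q = sqrt_iter D (Suc n)"
    and "p = sqrt_majorant n" and "q = sqrt_majorant (Suc n)"
  have P: "norm P \<le> p" and Q: "norm Q \<le> q" and d: "norm (Q - P) \<le> q - p"
    unfolding P_def Q_def p_def q_def by (fact norm_sqrt_iter[OF assms] Suc)+
  have "sqrt_iter D (Suc (Suc n)) - sqrt_iter D (Suc n)
      = (1/2) *\<^sub>R (D + (Q o\<^sub>L Q)) - (1/2) *\<^sub>R (D + (P o\<^sub>L P))"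
    by (simp add: P_def Q_def)
  also have "\<dots> = (1/2) *\<^sub>R ((Q o\<^sub>L (Q - P)) + ((Q - P) o\<^sub>L P))"
    by (rule blinfun_eqI) (simp add: blinfun.bilinear_simps flip: scaleR_right_diff_distrib)
  finally have "norm (sqrt_iter D (Suc (Suc n)) - sqrt_iter D (Suc n))
      \<le> (norm (Q o\<^sub>L (Q - P)) + norm ((Q - P) o\<^sub>L P)) / 2"
    using norm_triangle_ineq[of "Q o\<^sub>L (Q - P)" "(Q - P) o\<^sub>L P"] by simp
  also have "norm (Q o\<^sub>L (Q - P)) \<le> q * (q - p)"
    by (rule order_trans[OF norm_blinfun_compose])
       (intro mult_mono Q d norm_ge_zero order_trans[OF norm_ge_zero Q])
  also have "norm ((Q - P) o\<^sub>L P) \<le> (q - p) * p"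
    by (rule order_trans[OF norm_blinfun_compose])
       (intro mult_mono P d norm_ge_zero order_trans[OF norm_ge_zero d])
  also have "(q * (q - p) + (q - p) * p) / 2
      = sqrt_majorant (Suc (Suc n)) - sqrt_majorant (Suc n)"
    by (simp add: p_def q_def power2_eq_square field_simps)
  finally show ?case by simp
qed

lemma convergent_sqrt_iter:
  assumes "norm D \<le> 1"
  shows "convergent (sqrt_iter D)"
proof -
  have "incseq sqrt_majorant" by (rule incseq_SucI) (rule sqrt_majorant_mono)
  then obtain l where "sqrt_majorant \<longlonglongrightarrow> l"
    using incseq_convergent sqrt_majorant_bounds by metis
  then have "summable (\<lambda>n. sqrt_majorant (Suc n) - sqrt_majorant n)"
    by (rule telescope_summable)
  then have "summable (\<lambda>n. sqrt_iter D (Suc n) - sqrt_iter D n)"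
    by (rule summable_comparison_test[rotated]) (use norm_sqrt_iter_diff[OF assms] in blast)
  \<comment> \<open>The iteration starts at 0, so the partial sums are the iterates
    themselves.\<close>
  moreover have "(\<Sum>i<n. sqrt_iter D (Suc i) - sqrt_iter D i) = sqrt_iter D n" for n
    by (simp add: sum_lessThan_telescope del: sqrt_iter.simps(2))
  ultimately show ?thesis
    by (simp add: summable_iff_convergent del: sqrt_iter.simps(2))
qed

lemma sqrt_iter_symmetric:
  fixes D :: "'a::{real_inner, banach} \<Rightarrow>\<^sub>L 'a"
  assumes "\<And>x y. D x \<bullet> y = x \<bullet> D y"
  shows "sqrt_iter D n x \<bullet> y = x \<bullet> sqrt_iter D n y"
  by (induction n arbitrary: x y)
     (simp_all add: blinfun.bilinear_simps inner_add assms)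

text \<open>Every iterate is a polynomial in \<open>D\<close>. Passing to the limit, the square root
  inherits the commutation relations of the operator.\<close>

lemma sqrt_iter_commute:
  fixes D :: "'a::{real_inner, banach} \<Rightarrow>\<^sub>L 'a"
  assumes "D o\<^sub>L M = M o\<^sub>L D"
  shows "sqrt_iter D n (M x) = M (sqrt_iter D n x)"
proof -
  have "D (M x) = M (D x)" for x
    using arg_cong[OF assms, of "\<lambda>T. blinfun_apply T x"] by simp
  then show ?thesis
    by (induction n arbitrary: x) (simp_all add: blinfun.bilinear_simps)
qed

text \<open>With \<open>D = I - A\<close>, the iteration converges in norm to a solution of \<open>Y = (D + Y\<^sup>2) / 2\<close>,
  that is, of \<open>(I - Y)\<^sup>2 = A\<close>.\<close>

lemma blinfun_sqrt_exists:
  fixes A :: "'a::{real_inner, banach} \<Rightarrow>\<^sub>L 'a"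
  assumes sym: "\<And>x y. A x \<bullet> y = x \<bullet> A y" and pos: "\<And>x. 0 \<le> A x \<bullet> x"
  obtains R :: "'a \<Rightarrow>\<^sub>L 'a" where "\<And>x. R (R x) = A x" "\<And>x y. R x \<bullet> y = x \<bullet> R y"
    "\<And>x. 0 \<le> R x \<bullet> x" "\<And>M. A o\<^sub>L M = M o\<^sub>L A \<Longrightarrow> R o\<^sub>L M = M o\<^sub>L R"
proof -
  \<comment> \<open>Scaling by \<open>c\<close> puts the form of \<open>D = I - A / c\<close>
    between 0 and that of \<open>I\<close>; the summand 1 keeps \<open>c\<close> positive even for
    \<open>A = 0\<close>.\<close>
  define c where "c = norm A + 1"
  have c: "0 < c" unfolding c_def by (simp add: add_nonneg_pos)
  define D where "D = id_blinfun - (1 / c) *\<^sub>R A"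
  have Dx: "D x = x - (1 / c) *\<^sub>R A x" for x by (simp add: D_def blinfun.bilinear_simps)
  have symD: "D x \<bullet> y = x \<bullet> D y" for x y by (simp add: Dx inner_diff sym)
  have le: "A x \<bullet> x \<le> c * (x \<bullet> x)" for x
  proof -
    have "A x \<bullet> x \<le> norm (A x) * norm x" by (rule norm_cauchy_schwarz)
    also have "\<dots> \<le> (c * norm x) * norm x"
      using norm_blinfun[of A x]
      by (intro mult_right_mono) (simp_all add: c_def distrib_right add_increasing2)
    finally show ?thesis by (simp add: power2_norm_eq_inner[symmetric] power2_eq_square)
  qed
  have D1: "norm D \<le> 1"
  proof (rule norm_blinfun_positive_le)
    show "0 \<le> D x \<bullet> x" for x using le[of x] c by (simp add: Dx inner_diff field_simps)
    show "D x \<bullet> x \<le> x \<bullet> x" for x using pos[of x] c by (simp add: Dx inner_diff)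
  qed (rule symD)
  obtain Y where Y: "sqrt_iter D \<longlonglongrightarrow> Y"
    using convergent_sqrt_iter[OF D1] by (auto simp: convergent_def)
  have app: "(\<lambda>n. sqrt_iter D n x) \<longlonglongrightarrow> Y x" for x
    by (intro tendsto_intros Y)
  have "(\<lambda>n. sqrt_iter D (Suc n)) \<longlonglongrightarrow> (1/2) *\<^sub>R (D + (Y o\<^sub>L Y))"
    unfolding sqrt_iter.simps
    by (intro tendsto_intros bounded_bilinear.tendsto[OF bounded_bilinear_blinfun_compose] Y)
  then have Y_eq: "Y = (1/2) *\<^sub>R (D + (Y o\<^sub>L Y))"
    using LIMSEQ_unique LIMSEQ_Suc[OF Y] by blast
  have Y2: "Y (Y x) = 2 *\<^sub>R Y x - D x" for x
    using arg_cong[OF Y_eq, of "\<lambda>T. 2 *\<^sub>R blinfun_apply T x"] by (simp add: blinfun.bilinear_simps)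
  have symY: "Y x \<bullet> y = x \<bullet> Y y" for x y
  proof (rule LIMSEQ_unique)
    show "(\<lambda>n. sqrt_iter D n x \<bullet> y) \<longlonglongrightarrow> Y x \<bullet> y" by (intro tendsto_intros app)
    show "(\<lambda>n. sqrt_iter D n x \<bullet> y) \<longlonglongrightarrow> x \<bullet> Y y"
      unfolding sqrt_iter_symmetric[of D, OF symD] by (intro tendsto_intros app)
  qed
  \<comment> \<open>This makes the form of \<open>I - Y\<close> nonnegative, hence that of the
    root.\<close>
  have "norm Y \<le> 1"
    by (rule LIMSEQ_le_const2[OF tendsto_norm[OF Y]])
       (meson norm_sqrt_iter[OF D1] sqrt_majorant_bounds order_trans)
  have Yle: "Y x \<bullet> x \<le> x \<bullet> x" for x
  proof -
    have "norm (Y x) \<le> norm x"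
      using norm_blinfun[of Y x] mult_right_mono[OF \<open>norm Y \<le> 1\<close>, of "norm x"] by simp
    then have "norm (Y x) * norm x \<le> norm x * norm x" by (rule mult_right_mono) simp
    then show ?thesis
      using norm_cauchy_schwarz[of "Y x" x]
      by (simp add: power2_norm_eq_inner[symmetric] power2_eq_square)
  qed
  \<comment> \<open>By \<open>Y2\<close>, \<open>(I - Y)^2 = I - D = A / c\<close>; the factor
    \<open>sqrt c\<close> undoes the scaling.\<close>
  define R where "R = sqrt c *\<^sub>R (id_blinfun - Y)"
  have Rx: "R x = sqrt c *\<^sub>R (x - Y x)" for x by (simp add: R_def blinfun.bilinear_simps)
  have RR: "R (R x) = A x" for x
  proof -
    have "R (R x) = c *\<^sub>R (x - Y x - (Y x - Y (Y x)))"
      using c by (simp add: Rx blinfun.bilinear_simps flip: scaleR_right_diff_distrib)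
    also have "\<dots> = A x" using c by (simp add: Y2 Dx scaleR_2)
    finally show ?thesis .
  qed
  moreover have "R x \<bullet> y = x \<bullet> R y" for x y by (simp add: Rx inner_diff symY)
  moreover have "0 \<le> R x \<bullet> x" for x using Yle[of x] c by (simp add: Rx inner_diff)
  moreover have "R o\<^sub>L M = M o\<^sub>L R" if "A o\<^sub>L M = M o\<^sub>L A" for M
  proof -
    have "A (M x) = M (A x)" for x
      using arg_cong[OF that, of "\<lambda>T. blinfun_apply T x"] by simp
    then have "D o\<^sub>L M = M o\<^sub>L D"
      by (intro blinfun_eqI) (simp add: Dx blinfun.bilinear_simps)
    then have it: "sqrt_iter D n (M x) = M (sqrt_iter D n x)" for n x
      by (rule sqrt_iter_commute)
    have "Y (M x) = M (Y x)" for x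
    proof (rule LIMSEQ_unique)
      show "(\<lambda>n. sqrt_iter D n (M x)) \<longlonglongrightarrow> Y (M x)" by (rule app)
      show "(\<lambda>n. sqrt_iter D n (M x)) \<longlonglongrightarrow> M (Y x)"
        unfolding it by (intro tendsto_intros app)
    qed
    then show ?thesis by (intro blinfun_eqI) (simp add: Rx blinfun.bilinear_simps)
  qed
  ultimately show thesis by (rule that)
qed

text \<open>Commutation gives \<open>(R + S) (R - S) x = 0\<close>. At \<open>y = R x - S x\<close>
  both nonnegative forms therefore vanish, so \<open>R y = S y = 0\<close>, and by symmetry
  \<open>y \<bullet> y = x \<bullet> (R y - S y) = 0\<close>.\<close>

lemma commuting_positive_sqrt_unique:
  fixes R S :: "'a::real_inner \<Rightarrow> 'a"
  assumes R: "linear R" "\<And>x y. R x \<bullet> y = x \<bullet> R y" "\<And>x. 0 \<le> R x \<bullet> x"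
    and S: "linear S" "\<And>x y. S x \<bullet> y = x \<bullet> S y" "\<And>x. 0 \<le> S x \<bullet> x"
    and sq: "\<And>x. R (R x) = S (S x)" and comm: "\<And>x. R (S x) = S (R x)"
  shows "R x = S x"
proof -
  define y where "y = R x - S x"
  have "R y + S y = 0"
    by (simp add: y_def linear_diff[OF R(1)] linear_diff[OF S(1)] sq comm)
  then have "R y \<bullet> y + S y \<bullet> y = 0" by (simp flip: inner_add_left)
  then have "R y \<bullet> y = 0" "S y \<bullet> y = 0" using R(3)[of y] S(3)[of y] by linarith+
  then have "R y = 0" "S y = 0" using positive_form_kernel R S by blast+
  then have "y \<bullet> y = 0"
    using R(2)[of x y] S(2)[of x y] inner_diff_left[of "R x" "S x" y] by (simp flip: y_def)
  then show ?thesis by (simp add: y_def)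
qed

subsection \<open>Complex inner products in terms of their real parts\<close>

text \<open>Multiplication by \<open>\<i>\<close> exposes the imaginary part as a real inner
  product, so complex identities reduce to pairs of real ones.\<close>

lemma inner_i_left: "inner (\<i> *\<^sub>C x) y = - Im (cinner x y)"
  by (simp add: inner_eq_Re_cinner cinner_scaleC_left)

lemma inner_i_swap: "inner (\<i> *\<^sub>C x) y = - inner x (\<i> *\<^sub>C y)"
  using cinner_commute[of x y] inner_i_left[of x y] inner_i_left[of y x]
  by (simp add: inner_commute)

lemma i_scaleC_i: "\<i> *\<^sub>C (\<i> *\<^sub>C x) = - x"
  using scaleC_of_real[of "-1" x] by (simp add: scaleC_scaleC)

lemma inner_i_i: "inner (\<i> *\<^sub>C x) (\<i> *\<^sub>C y) = inner x y"
  by (simp add: inner_i_swap i_scaleC_i)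

lemma scaleC_Re_Im: "c *\<^sub>C x = Re c *\<^sub>R x + Im c *\<^sub>R (\<i> *\<^sub>C x)"
proof -
  have "c *\<^sub>C x = (of_real (Re c) + of_real (Im c) * \<i>) *\<^sub>C x"
    by (subst complex_eq[of c]) (simp add: mult.commute)
  then show ?thesis by (simp only: scaleC_add_left scaleC_of_real flip: scaleC_scaleC)
qed

lemma cinner_eqI:
  assumes "inner x y = inner x' y'" "inner (\<i> *\<^sub>C x) y = inner (\<i> *\<^sub>C x') y'"
  shows "cinner x y = cinner x' y'"
  using assms by (simp add: complex_eq_iff inner_eq_Re_cinner cinner_scaleC_left)

text \<open>Allows complex scalars among the real-linear operators \<open>M\<close> that commute
  with a square root.\<close>

lemma bounded_linear_scaleC: "bounded_linear (\<lambda>x::'a::complex_inner. c *\<^sub>C x)"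
proof
  show "c *\<^sub>C (x + y) = c *\<^sub>C x + c *\<^sub>C y" for x y :: 'a by (rule scaleC_add_right)
  show "c *\<^sub>C (r *\<^sub>R x) = r *\<^sub>R (c *\<^sub>C x)" for r and x :: 'a
    by (metis scaleC_of_real scaleC_scaleC mult.commute)
  have "norm (\<i> *\<^sub>C x) = norm x" for x :: 'a by (simp add: norm_eq_sqrt_inner inner_i_i)
  then have "norm (c *\<^sub>C x) \<le> \<bar>Re c\<bar> * norm x + \<bar>Im c\<bar> * norm x" for x :: 'a
    using norm_triangle_ineq[of "Re c *\<^sub>R x" "Im c *\<^sub>R (\<i> *\<^sub>C x)"] scaleC_Re_Im[of c x] by simp
  then have "norm (c *\<^sub>C x) \<le> norm x * (\<bar>Re c\<bar> + \<bar>Im c\<bar>)" for x :: 'a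
    by (simp add: algebra_simps)
  then show "\<exists>K. \<forall>x::'a. norm (c *\<^sub>C x) \<le> norm x * K" by blast
qed

lemma bounded_clinearI:
  assumes "bounded_linear T" "\<And>x. T (\<i> *\<^sub>C x) = \<i> *\<^sub>C T x"
  shows "bounded_clinear T"
proof -
  interpret bounded_linear T by fact
  have "T (c *\<^sub>C x) = c *\<^sub>C T x" for c x
    by (subst (1 2) scaleC_Re_Im) (simp add: add scaleR assms(2))
  then show ?thesis using assms(1) by (simp add: bounded_clinear_def clinear_on_def add)
qed

lemma positive_op_bounded_linear: "positive_op A \<Longrightarrow> bounded_linear A"
  by (simp add: positive_op_def bounded_clinear_def)

lemma positive_op_linear: "positive_op A \<Longrightarrow> linear A"
  by (rule bounded_linear.linear[OF positive_op_bounded_linear])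

lemma positive_op_scaleC: "positive_op A \<Longrightarrow> A (c *\<^sub>C x) = c *\<^sub>C A x"
  by (simp add: positive_op_def bounded_clinear_def clinear_on_def)

lemma positive_op_inner_nonneg: "positive_op A \<Longrightarrow> 0 \<le> inner (A x) x"
  by (simp add: positive_op_def inner_eq_Re_cinner complex_nonneg_Reals_iff)

text \<open>Since \<open>cinner (A z) z\<close> is real, \<open>inner (\<i> *\<^sub>C A z) z\<close>
  vanishes for all \<open>z\<close>. Polarising at \<open>z = \<i> *\<^sub>C x + y\<close> leaves
  exactly the symmetry relation.\<close>

lemma positive_op_symmetric:
  assumes "positive_op A"
  shows "inner (A x) y = inner x (A y)"
proof -
  have zero: "inner (\<i> *\<^sub>C A z) z = 0" for z
    using assms by (simp add: positive_op_def inner_i_left complex_nonneg_Reals_iff)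
  have A_add: "A (u + v) = A u + A v" for u v
    by (rule linear_add[OF positive_op_linear[OF assms]])
  have "inner (\<i> *\<^sub>C A (\<i> *\<^sub>C x)) y + inner (\<i> *\<^sub>C A y) (\<i> *\<^sub>C x) = 0"
    using zero[of "\<i> *\<^sub>C x + y"] zero[of "\<i> *\<^sub>C x"] zero[of y]
    unfolding A_add scaleC_add_right inner_add by linarith
  then have "- inner (A x) y + inner (A y) x = 0"
    unfolding positive_op_scaleC[OF assms] i_scaleC_i inner_i_i inner_minus_left .
  then show ?thesis by (simp add: inner_commute[of x])
qed

text \<open>What remains is that \<open>cinner (A x) x\<close> is real: complex linearity, symmetry
  and the skewness of \<open>\<i>\<close> make \<open>inner (\<i> *\<^sub>C A x) x\<close> its own
  negative.\<close>

lemma positive_opI: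
  assumes "bounded_clinear A" "\<And>x y. inner (A x) y = inner x (A y)" "\<And>x. 0 \<le> inner (A x) x"
  shows "positive_op A"
proof -
  have "inner (\<i> *\<^sub>C A x) x = 0" for x
  proof -
    have "A (\<i> *\<^sub>C x) = \<i> *\<^sub>C A x"
      using assms(1) by (simp add: bounded_clinear_def clinear_on_def)
    then have "inner (\<i> *\<^sub>C A x) x = inner (\<i> *\<^sub>C x) (A x)" using assms(2)[of "\<i> *\<^sub>C x" x] by simp
    then show ?thesis using inner_i_swap[of "A x" x] by (simp add: inner_commute)
  qed
  then have "Im (cinner (A x) x) = 0" for x using inner_i_left[of "A x" x] by simp
  then show ?thesis
    using assms(1,3) by (simp add: positive_op_def complex_nonneg_Reals_iff inner_eq_Re_cinner)
qed

text \<open>Existence and uniqueness of the positive root make the definite description in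
  \<open>op_sqrt\<close> meaningful.\<close>

lemma op_sqrt_positive_root:
  fixes A :: "'a::chilbert_space \<Rightarrow> 'a"
  assumes A: "positive_op A"
  shows "positive_op (op_sqrt A) \<and> op_sqrt A \<circ> op_sqrt A = A"
proof -
  define A' where "A' = Blinfun A"
  have A': "blinfun_apply A' = A"
    unfolding A'_def by (rule bounded_linear_Blinfun_apply[OF positive_op_bounded_linear[OF A]])
  have sym: "A' x \<bullet> y = x \<bullet> A' y" and pos: "0 \<le> A' x \<bullet> x" for x y
    unfolding A' by (rule positive_op_symmetric[OF A] positive_op_inner_nonneg[OF A])+
  obtain R :: "'a \<Rightarrow>\<^sub>L 'a" where R: "\<And>x. R (R x) = A' x" "\<And>x y. R x \<bullet> y = x \<bullet> R y"
    "\<And>x. 0 \<le> R x \<bullet> x" "\<And>M. A' o\<^sub>L M = M o\<^sub>L A' \<Longrightarrow> R o\<^sub>L M = M o\<^sub>L R"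
    by (rule blinfun_sqrt_exists[OF sym pos]) blast
  have RR: "R (R x) = A x" for x by (simp add: R(1) A')
  have comm: "R (M x) = M (R x)" if "bounded_linear M" "\<And>x. A (M x) = M (A x)" for M x
  proof -
    have M: "blinfun_apply (Blinfun M) = M" by (rule bounded_linear_Blinfun_apply[OF that(1)])
    have "A' o\<^sub>L Blinfun M = Blinfun M o\<^sub>L A'" by (intro blinfun_eqI) (simp add: A' M that(2))
    from arg_cong[OF R(4)[OF this], of "\<lambda>T. blinfun_apply T x"] show ?thesis by (simp add: M)
  qed
  \<comment> \<open>The root was built real-linearly; it is complex linear because \<open>A\<close>,
    and hence \<open>R\<close>, commutes with multiplication by \<open>\<i>\<close>.\<close>
  have R_pos: "positive_op R"
    by (intro positive_opI bounded_clinearI R(2,3) comm[OF bounded_linear_scaleC]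
        positive_op_scaleC[OF A] blinfun.bounded_linear_right)
  then have "positive_op R \<and> R \<circ> R = A" by (simp add: fun_eq_iff RR)
  moreover have "Q = R" if "positive_op Q \<and> Q \<circ> Q = A" for Q
  proof
    fix x
    have Q: "positive_op Q" and QQ: "Q (Q y) = A y" for y using that by (simp_all add: fun_eq_iff)
    \<comment> \<open>Any other root \<open>Q\<close> commutes with its square \<open>A\<close>, and
      therefore with \<open>R\<close>.\<close>
    have QR: "R (Q y) = Q (R y)" for y
      by (rule comm[OF positive_op_bounded_linear[OF Q]]) (simp flip: QQ)
    show "Q x = R x"
      by (rule commuting_positive_sqrt_unique[OF
            positive_op_linear[OF Q] positive_op_symmetric[OF Q] positive_op_inner_nonneg[OF Q]
            positive_op_linear[OF R_pos] R(2,3)]) (simp_all only: QQ RR QR)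
  qed
  ultimately have "\<exists>!R. positive_op R \<and> R \<circ> R = A"
    by (intro ex1I[where P = "\<lambda>R. positive_op R \<and> R \<circ> R = A" and a = "blinfun_apply R"])
  then show ?thesis unfolding op_sqrt_def
    by (rule theI'[where P = "\<lambda>R. positive_op R \<and> R \<circ> R = A"])
qed

subsection \<open>Adjoints of contractions\<close>

lemma csubspace_imp_subspace: "csubspace V \<Longrightarrow> subspace V"
  unfolding csubspace_def subspace_def using scaleC_of_real by metis

text \<open>Real Riesz representation of \<open>z \<mapsto> inner (T z) h\<close>; testing also with
  \<open>\<i> *\<^sub>C z\<close> upgrades it to the complex identity defining
  \<open>adjoint_on\<close>.\<close>

lemma adjoint_on_contraction:
  fixes K :: "'k::complex_inner set" and T :: "'k \<Rightarrow> 'a::chilbert_space"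
  assumes K: "csubspace K" "complete K" and T: "contraction_on K T"
  shows "adjoint_on K T h \<in> K" "\<And>z. z \<in> K \<Longrightarrow> inner (T z) h = inner z (adjoint_on K T h)"
proof -
  have sub: "subspace K" by (rule csubspace_imp_subspace[OF K(1)])
  have Tc: "T (c *\<^sub>C x) = c *\<^sub>C T x" and Tn: "norm (T x) \<le> norm x" if "x \<in> K" for c x
    using T that by (auto simp: contraction_on_def clinear_on_def)
  have Tadd: "T (x + y) = T x + T y" if "x \<in> K" "y \<in> K" for x y
    using T that by (auto simp: contraction_on_def clinear_on_def)
  have "\<exists>k\<in>K. \<forall>z\<in>K. T z \<bullet> h = z \<bullet> k"
  proof (rule riesz_representation_on[OF sub K(2), where M = "norm h"])
    fix x y assume "x \<in> K" "y \<in> K"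
    then show "T (x + y) \<bullet> h = T x \<bullet> h + T y \<bullet> h" by (simp add: Tadd inner_add)
  next
    fix r x assume "x \<in> K"
    then show "T (r *\<^sub>R x) \<bullet> h = r * (T x \<bullet> h)"
      \<comment> \<open>\<open>T\<close> is homogeneous for \<open>*\<^sub>C\<close>, so the real
        scalar is first read as a complex one.\<close>
      by (simp add: Tc flip: scaleC_of_real) (simp add: scaleC_of_real)
  next
    fix x assume "x \<in> K"
    then have "norm (T x) * norm h \<le> norm x * norm h" using Tn by (intro mult_right_mono) auto
    then show "\<bar>T x \<bullet> h\<bar> \<le> norm h * norm x"
      using Cauchy_Schwarz_ineq2[of "T x" h] by (simp add: mult.commute)
  qed
  then obtain k where k: "k \<in> K" "\<And>z. z \<in> K \<Longrightarrow> T z \<bullet> h = z \<bullet> k" by blast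
  have "cinner (T z) h = cinner z k" if "z \<in> K" for z
  proof (rule cinner_eqI)
    have "\<i> *\<^sub>C z \<in> K" using K(1) that by (simp add: csubspace_def)
    then show "(\<i> *\<^sub>C T z) \<bullet> h = (\<i> *\<^sub>C z) \<bullet> k" using k(2)[of "\<i> *\<^sub>C z"] that by (simp add: Tc)
  qed (rule k(2)[OF that])
  moreover have "k' = k" if k': "k' \<in> K" "\<forall>z\<in>K. cinner (T z) h = cinner z k'" for k'
  proof -
    have "k' - k \<in> K" using k'(1) k(1) sub by (simp add: subspace_diff)
    then have "(k' - k) \<bullet> k' = (k' - k) \<bullet> k" using k(2) k'(2) by (simp add: inner_eq_Re_cinner)
    then have "(k' - k) \<bullet> (k' - k) = 0" by (simp only: inner_diff_right)
    then show ?thesis by simp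
  qed
  ultimately have "adjoint_on K T h = k"
    unfolding adjoint_on_def using k(1) by (intro the_equality) auto
  then show "adjoint_on K T h \<in> K" "\<And>z. z \<in> K \<Longrightarrow> inner (T z) h = inner z (adjoint_on K T h)"
    using k by auto
qed

text \<open>Linearity of the adjoint follows from uniqueness of the representing vector. Its norm
  bound comes from \<open>(norm k)^2 = inner (T k) h\<close> for
  \<open>k = adjoint_on K T h\<close>.\<close>

lemma bounded_clinear_comp_adjoint_on:
  fixes K :: "'k::complex_inner set" and T :: "'k \<Rightarrow> 'a::chilbert_space"
  assumes K: "csubspace K" "complete K" and T: "contraction_on K T"
  shows "bounded_clinear (\<lambda>h. T (adjoint_on K T h))"
proof -
  note adj = adjoint_on_contraction[OF K T]
  have sub: "subspace K" by (rule csubspace_imp_subspace[OF K(1)])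
  have Tc: "T (c *\<^sub>C x) = c *\<^sub>C T x" and Tn: "norm (T x) \<le> norm x" if "x \<in> K" for c x
    using T that by (auto simp: contraction_on_def clinear_on_def)
  have Tadd: "T (x + y) = T x + T y" if "x \<in> K" "y \<in> K" for x y
    using T that by (auto simp: contraction_on_def clinear_on_def)
  have unique: "adjoint_on K T h = k" if "k \<in> K" "\<And>z. z \<in> K \<Longrightarrow> T z \<bullet> h = z \<bullet> k" for h k
  proof -
    have "adjoint_on K T h - k \<in> K" using that(1) adj(1) sub by (simp add: subspace_diff)
    then have "(adjoint_on K T h - k) \<bullet> (adjoint_on K T h - k) = 0"
      using adj(2)[of _ h] that(2) by (simp add: inner_diff_right)
    then show ?thesis by simp
  qed
  have a_add: "adjoint_on K T (g + h) = adjoint_on K T g + adjoint_on K T h" for g h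
    by (rule unique) (auto simp: inner_add adj sub subspace_add)
  have a_i: "adjoint_on K T (\<i> *\<^sub>C h) = \<i> *\<^sub>C adjoint_on K T h" for h
  proof (rule unique)
    show "\<i> *\<^sub>C adjoint_on K T h \<in> K" using K(1) adj(1) by (simp add: csubspace_def)
    fix z assume z: "z \<in> K"
    then have "\<i> *\<^sub>C z \<in> K" using K(1) by (simp add: csubspace_def)
    from adj(2)[OF this, of h] show "T z \<bullet> (\<i> *\<^sub>C h) = z \<bullet> (\<i> *\<^sub>C adjoint_on K T h)"
      using z by (simp add: Tc inner_i_swap)
  qed
  have a_scaleR: "adjoint_on K T (r *\<^sub>R h) = r *\<^sub>R adjoint_on K T h" for r h
    by (rule unique) (auto simp: adj sub subspace_scale)
  have a_norm: "norm (adjoint_on K T h) \<le> norm h" for h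
  proof -
    let ?k = "adjoint_on K T h"
    have "norm ?k * norm ?k = T ?k \<bullet> h"
      using adj(2)[OF adj(1), of h h] by (simp add: power2_norm_eq_inner flip: power2_eq_square)
    also have "\<dots> \<le> norm (T ?k) * norm h" by (rule norm_cauchy_schwarz)
    also have "\<dots> \<le> norm ?k * norm h" by (intro mult_right_mono Tn adj) auto
    finally show ?thesis
      by (metis mult_left_le_imp_le norm_ge_zero order_le_less)
  qed
  have "T (adjoint_on K T (r *\<^sub>R h)) = r *\<^sub>R T (adjoint_on K T h)" for r h
    using Tc[OF adj(1), of "of_real r" h] by (simp add: a_scaleR scaleC_of_real)
  moreover have "norm (T (adjoint_on K T h)) \<le> norm h * 1" for h
    using Tn[OF adj(1)] a_norm order_trans by fastforce
  ultimately have "bounded_linear (\<lambda>h. T (adjoint_on K T h))"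
    by (intro bounded_linear_intro[where K = 1]) (auto simp: a_add Tadd adj)
  then show ?thesis by (rule bounded_clinearI) (simp add: a_i Tc[OF adj(1)])
qed

subsection \<open>The parallel sum\<close>

text \<open>A competitor \<open>U\<close> has the same quadratic form, and \<open>U - T\<close> is
  symmetric, so it vanishes.\<close>

lemma parallel_sum_eqI:
  assumes T: "positive_op T"
    and form: "\<And>x. inner (T x) x = (INF y. inner (A (x - y)) (x - y) + inner (B y) y)"
  shows "parallel_sum A B = T"
  unfolding parallel_sum_def
proof (rule the_equality)
  have real: "cinner (T x) x = complex_of_real (inner (T x) x)" for x
    using T by (simp add: positive_op_def complex_nonneg_Reals_iff inner_eq_Re_cinner complex_eq_iff)
  then show "positive_op T \<and> (\<forall>x. cinner (T x) x =
      complex_of_real (INF y. Re (cinner (A (x - y)) (x - y)) + Re (cinner (B y) y)))"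
    using T by (simp only: real form simp_thms flip: inner_eq_Re_cinner)
next
  fix U
  assume U: "positive_op U \<and> (\<forall>x. cinner (U x) x =
      complex_of_real (INF y. Re (cinner (A (x - y)) (x - y)) + Re (cinner (B y) y)))"
  then have "inner (U x) x = inner (T x) x" for x
    unfolding form by (simp add: inner_eq_Re_cinner)
  then have "U x - T x = 0" for x
    using U T
    by (intro symmetric_form_zero_imp[of "\<lambda>x. U x - T x"] linear_compose_sub)
       (auto simp: positive_op_linear inner_diff positive_op_symmetric)
  then show "U = T" by auto
qed

lemma parallel_sum_commute: "parallel_sum A B = parallel_sum B A"
proof -
  have "(INF y. f (x - y) + g y) = (INF y. g (x - y) + f y)" for f g :: "'a \<Rightarrow> real" and x
  proof -
    \<comment> \<open>The substitution of \<open>x - y\<close> for \<open>y\<close> is a bijection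
      exchanging the two summands.\<close>
    have "range (\<lambda>y. g (x - y) + f y) = range ((\<lambda>y. f (x - y) + g y) \<circ> (\<lambda>y. x - y))"
      by (simp add: comp_def add.commute)
    also have "\<dots> = range (\<lambda>y. f (x - y) + g y)"
      by (simp only: image_comp[symmetric]) (simp add: surj_diff_right)
    finally show ?thesis by simp
  qed
  note swap = this[of "\<lambda>z. Re (cinner (A z) z)" _ "\<lambda>z. Re (cinner (B z) z)"]
  show ?thesis unfolding parallel_sum_def swap ..
qed

lemma parallel_sum_eq_sqrt_adjoint:
  fixes A B :: "'a::chilbert_space \<Rightarrow> 'a" and K :: "'k::complex_inner set"
  assumes A: "positive_op A" and B: "positive_op B"
    and comp: "range_completion (\<lambda>x. A x + B x) K j"
    and S: "contraction_on K S" and Sj: "\<And>x. S (j (A x + B x)) = op_sqrt A x"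
  shows "parallel_sum A B = op_sqrt A \<circ> (\<lambda>h. h - S (adjoint_on K S h)) \<circ> op_sqrt A"
proof (rule parallel_sum_eqI)
  define a where "a = op_sqrt A"
  define V where "V x = j (A x + B x)" for x
  define P where "P h = adjoint_on K S h" for h
  have K: "csubspace K" "complete K" and VK: "\<And>x. V x \<in> K" and KV: "K \<subseteq> closure (range V)"
    and VV: "\<And>x. V x \<bullet> V x = A x \<bullet> x + B x \<bullet> x"
    using comp unfolding range_completion_def V_def
    by (auto simp: inner_eq_Re_cinner image_image cinner_add_left)
  have a: "positive_op a" and aa: "\<And>x. a (a x) = A x"
    using op_sqrt_positive_root[OF A] by (auto simp: a_def fun_eq_iff)
  note a_sym = positive_op_symmetric[OF a] and a_lin = positive_op_linear[OF a]
  have P: "P h \<in> K" and SP: "z \<in> K \<Longrightarrow> S z \<bullet> h = z \<bullet> P h" for h z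
    unfolding P_def by (rule adjoint_on_contraction[OF K S], assumption?)+
  have SV: "S (V x) = a x" for x by (simp add: V_def a_def Sj)
  define T where "T = a \<circ> (\<lambda>h. h - S (P h)) \<circ> a"
  \<comment> \<open>The adjoint relation turns \<open>S (P (a x)) \<bullet> a y\<close> into
    \<open>P (a x) \<bullet> P (a y)\<close>; the result also shows that \<open>T\<close> is
    symmetric.\<close>
  have Tform: "T x \<bullet> y = a x \<bullet> a y - P (a x) \<bullet> P (a y)" for x y
    by (simp add: T_def a_sym inner_diff_left SP P)
  define q where "q x y = A (x - y) \<bullet> (x - y) + B y \<bullet> y" for x y
  have q: "q x y = T x \<bullet> x + (norm (P (a x) - V y))\<^sup>2" for x y
  proof -
    have "a x \<bullet> a y = P (a x) \<bullet> V y"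
      using SP[OF VK, of y "a x"] by (simp add: SV inner_commute)
    moreover have "A z \<bullet> z = a z \<bullet> a z" for z unfolding aa[symmetric] by (rule a_sym)
    moreover from this have "A (x - y) \<bullet> (x - y) = a x \<bullet> a x - 2 * (a x \<bullet> a y) + a y \<bullet> a y"
      by (simp add: linear_diff[OF a_lin] inner_diff inner_commute)
    moreover have "(norm (P (a x) - V y))\<^sup>2
        = P (a x) \<bullet> P (a x) - 2 * (P (a x) \<bullet> V y) + V y \<bullet> V y"
      by (simp add: power2_norm_eq_inner inner_diff inner_commute)
    ultimately show ?thesis
      using Tform[of x x] VV[of y] unfolding q_def by simp
  qed
  have q_nonneg: "0 \<le> q x y" for x y
    by (simp add: q_def positive_op_inner_nonneg A B)
  \<comment> \<open>Density of the range of \<open>V\<close> in \<open>K\<close> makes the square in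
    \<open>q\<close> arbitrarily small.\<close>
  have near: "\<exists>y. q x y < T x \<bullet> x + e" if "0 < e" for x e
  proof -
    have "P (a x) \<in> closure (range V)" using P KV by blast
    moreover have "0 < sqrt e" using that by simp
    ultimately obtain y where "dist (V y) (P (a x)) < sqrt e"
      unfolding closure_approachable by blast
    then have "(norm (P (a x) - V y))\<^sup>2 < (sqrt e)\<^sup>2"
      by (intro power_strict_mono) (auto simp: dist_norm norm_minus_commute)
    then have "q x y < T x \<bullet> x + e" using that by (simp add: q)
    then show ?thesis ..
  qed
  have "T x \<bullet> x = (INF y. q x y)" for x
  proof (rule antisym)
    show "T x \<bullet> x \<le> (INF y. q x y)" by (rule cINF_greatest) (simp_all add: q)
    show "(INF y. q x y) \<le> T x \<bullet> x"
    proof (rule field_le_epsilon)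
      fix e :: real assume "0 < e"
      then obtain y where "q x y < T x \<bullet> x + e" using near by blast
      moreover have "(INF y. q x y) \<le> q x y"
        by (rule cINF_lower) (auto intro!: bdd_belowI2 q_nonneg)
      ultimately show "(INF y. q x y) \<le> T x \<bullet> x + e" by simp
    qed
  qed
  then show "((op_sqrt A \<circ> (\<lambda>h. h - S (adjoint_on K S h)) \<circ> op_sqrt A) x) \<bullet> x
      = (INF y. A (x - y) \<bullet> (x - y) + B y \<bullet> y)" for x
    by (simp add: T_def a_def P_def q_def)
  have SPc: "bounded_clinear (\<lambda>h. S (P h))"
    unfolding P_def by (rule bounded_clinear_comp_adjoint_on[OF K S])
  have "bounded_clinear T"
  proof (rule bounded_clinearI)
    have "bounded_linear (\<lambda>h. h - S (P h))"
      using SPc by (intro bounded_linear_sub bounded_linear_ident) (simp add: bounded_clinear_def)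
    then show "bounded_linear T"
      unfolding T_def comp_def
      by (intro bounded_linear_compose[OF positive_op_bounded_linear[OF a]]
          bounded_linear_compose[OF _ positive_op_bounded_linear[OF a]])
    show "T (\<i> *\<^sub>C x) = \<i> *\<^sub>C T x" for x
      using SPc by (simp add: T_def positive_op_scaleC[OF a] bounded_clinear_def clinear_on_def
          flip: linear_diff[OF bounded_linear.linear[OF bounded_linear_scaleC]])
  qed
  \<comment> \<open>Positivity is read off the approximation of \<open>T x \<bullet> x\<close> by
    the nonnegative values \<open>q x y\<close>.\<close>
  moreover have "0 \<le> T x \<bullet> x" for x
  proof (rule field_le_epsilon)
    fix e :: real assume "0 < e"
    then obtain y where "q x y < T x \<bullet> x + e" using near by blast
    then show "0 \<le> T x \<bullet> x + e" using q_nonneg[of x y] by linarith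
  qed
  moreover have "T x \<bullet> y = x \<bullet> T y" for x y
    using Tform[of x y] Tform[of y x] by (simp add: inner_commute)
  ultimately have "positive_op T" by (intro positive_opI)
  then show "positive_op (op_sqrt A \<circ> (\<lambda>h. h - S (adjoint_on K S h)) \<circ> op_sqrt A)"
    by (simp add: T_def a_def P_def)
qed

theorem corollary2p6:
  fixes A B :: "'a::chilbert_space \<Rightarrow> 'a"
    and K :: "'k::complex_inner set"
    and j :: "'a \<Rightarrow> 'k"
    and S\<^sub>A S\<^sub>B :: "'k \<Rightarrow> 'a"
  assumes "positive_op A" and "positive_op B"
    and "range_completion (\<lambda>x. A x + B x) K j"
    and "contraction_on K S\<^sub>A" and "\<And>x. S\<^sub>A (j (A x + B x)) = op_sqrt A x"
    and "contraction_on K S\<^sub>B" and "\<And>x. S\<^sub>B (j (A x + B x)) = op_sqrt B x"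
  shows "parallel_sum A B = op_sqrt A \<circ> (\<lambda>h. h - S\<^sub>A (adjoint_on K S\<^sub>A h)) \<circ> op_sqrt A \<and>
         parallel_sum A B = op_sqrt B \<circ> (\<lambda>h. h - S\<^sub>B (adjoint_on K S\<^sub>B h)) \<circ> op_sqrt B"
proof
  show "parallel_sum A B = op_sqrt A \<circ> (\<lambda>h. h - S\<^sub>A (adjoint_on K S\<^sub>A h)) \<circ> op_sqrt A"
    using assms(1-5) by (rule parallel_sum_eq_sqrt_adjoint)
  \<comment> \<open>As \<open>B + A = A + B\<close>, the same completion \<open>K\<close>,
    \<open>j\<close> serves with the roles of \<open>A\<close> and \<open>B\<close>
    exchanged.\<close>
  have "parallel_sum B A = op_sqrt B \<circ> (\<lambda>h. h - S\<^sub>B (adjoint_on K S\<^sub>B h)) \<circ> op_sqrt B"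
    using assms(1,2,3,6,7)
    by (intro parallel_sum_eq_sqrt_adjoint[where j = j]) (simp_all add: add.commute[of "B _"])
  then show "parallel_sum A B = op_sqrt B \<circ> (\<lambda>h. h - S\<^sub>B (adjoint_on K S\<^sub>B h)) \<circ> op_sqrt B"
    by (simp only: parallel_sum_commute[of A B])
qed

end
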